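(* A group $G$ is post-injunctive if and only if it is locally post-injunctive, i.e. if and only if every finitely generated subgroup of $G$ is post-injunctive.
   Context: For a group $G$ and a set $A$ (the alphabet), $A^G$ is the set of all maps $x\colon G\to A$ (configurations), with shift action $(gx)(h)=x(g^{-1}h)$. A cellular automaton $\tau\colon A^G\to A^G$ is a map for which there exist a finite subset $M\subset G$ (a memory set) and a map $\mu\colon A^M\to A$ (the local transition map) such that $\tau(x)(g)=\mu((g^{-1}x)|_M)$ for all $x\in A^G$, $g\in G$. Two configurations $x,y\in A^G$ are asymptotic if $x|_{G\setminus E}=y|_{G\setminus E}$ for some finite $E\subset G$. The cellular automaton $\tau$ is pre-injective if for all asymptotic $x,y\in A^G$, $\tau(x)=\tau(y)$ implies $x=y$. It is post-surjective if for all $x,y\in A^G$ with $y$ asymptotic to $\tau(x)$, there exists $z\in A^G$ asymptotic to $x$ with $\tau(z)=y$. A group $G$ is post-injunctive if for every finite alphabet $A$, every post-surjective cellular automaton $\tau\colon A^G\to A^G$ is pre-injective. *)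

theory Defs
  imports "HOL-Algebra.Generated_Groups" "HOL-Library.FuncSet"
begin

text \<open>
  Groups are those of HOL-Algebra. A configuration is an extensional function on the carrier,
  so that equality of configurations is equality of HOL functions, and patterns on a
  set \<open>M\<close> are the elements of \<open>M \<rightarrow>\<^sub>E A\<close>.
\<close>

definition configs :: "('g, 'm) monoid_scheme \<Rightarrow> 'a set \<Rightarrow> ('g \<Rightarrow> 'a) set"
  where "configs G A = carrier G \<rightarrow>\<^sub>E A"

definition shift :: "('g, 'm) monoid_scheme \<Rightarrow> 'g \<Rightarrow> ('g \<Rightarrow> 'a) \<Rightarrow> 'g \<Rightarrow> 'a"
  where "shift G g x = (\<lambda>h\<in>carrier G. x (inv\<^bsub>G\<^esub> g \<otimes>\<^bsub>G\<^esub> h))"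

text \<open>The values of \<open>\<tau>\<close> outside \<open>configs G A\<close> are irrelevant to all notions below.\<close>

definition cellular_automaton ::
    "('g, 'm) monoid_scheme \<Rightarrow> 'a set \<Rightarrow> (('g \<Rightarrow> 'a) \<Rightarrow> 'g \<Rightarrow> 'a) \<Rightarrow> bool"
  where "cellular_automaton G A \<tau> \<longleftrightarrow>
    \<tau> \<in> configs G A \<rightarrow> configs G A \<and>
    (\<exists>M \<mu>. finite M \<and> M \<subseteq> carrier G \<and> \<mu> \<in> (M \<rightarrow>\<^sub>E A) \<rightarrow> A \<and>
      (\<forall>x\<in>configs G A. \<forall>g\<in>carrier G.
         \<tau> x g = \<mu> (restrict (shift G (inv\<^bsub>G\<^esub> g) x) M)))"

definition asymptotic ::
    "('g, 'm) monoid_scheme \<Rightarrow> ('g \<Rightarrow> 'a) \<Rightarrow> ('g \<Rightarrow> 'a) \<Rightarrow> bool"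
  where "asymptotic G x y \<longleftrightarrow>
    (\<exists>E. finite E \<and> E \<subseteq> carrier G \<and>
      restrict x (carrier G - E) = restrict y (carrier G - E))"

definition pre_injective ::
    "('g, 'm) monoid_scheme \<Rightarrow> 'a set \<Rightarrow> (('g \<Rightarrow> 'a) \<Rightarrow> 'g \<Rightarrow> 'a) \<Rightarrow> bool"
  where "pre_injective G A \<tau> \<longleftrightarrow>
    (\<forall>x\<in>configs G A. \<forall>y\<in>configs G A. asymptotic G x y \<longrightarrow> \<tau> x = \<tau> y \<longrightarrow> x = y)"

definition post_surjective ::
    "('g, 'm) monoid_scheme \<Rightarrow> 'a set \<Rightarrow> (('g \<Rightarrow> 'a) \<Rightarrow> 'g \<Rightarrow> 'a) \<Rightarrow> bool"
  where "post_surjective G A \<tau> \<longleftrightarrow>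
    (\<forall>x\<in>configs G A. \<forall>y\<in>configs G A. asymptotic G y (\<tau> x) \<longrightarrow>
      (\<exists>z\<in>configs G A. asymptotic G z x \<and> \<tau> z = y))"

text \<open>
  HOL cannot quantify over types inside a definition, so the alphabets are the finite subsets of
  \<^typ>\<open>nat\<close>; every finite set is in bijection with one of these, and the lemma
  \<open>post_injunctiveD\<close> below gives the property for finite alphabets in an arbitrary type.
\<close>

definition post_injunctive :: "('g, 'm) monoid_scheme \<Rightarrow> bool"
  where "post_injunctive G \<longleftrightarrow>
    (\<forall>(A :: nat set) \<tau>. finite A \<longrightarrow> cellular_automaton G A \<tau> \<longrightarrow> post_surjective G A \<tau> \<longrightarrow>
      pre_injective G A \<tau>)"

definition finitely_generated :: "('g, 'm) monoid_scheme \<Rightarrow> bool"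
  where "finitely_generated G \<longleftrightarrow>
    (\<exists>S. finite S \<and> S \<subseteq> carrier G \<and> generate G S = carrier G)"

definition locally_post_injunctive :: "('g, 'm) monoid_scheme \<Rightarrow> bool"
  where "locally_post_injunctive G \<longleftrightarrow>
    (\<forall>H. subgroup H G \<longrightarrow> finitely_generated (G\<lparr>carrier := H\<rparr>) \<longrightarrow>
      post_injunctive (G\<lparr>carrier := H\<rparr>))"

lemma asymptotic_compose:
  assumes "asymptotic G x y"
  shows "asymptotic G (compose (carrier G) f x) (compose (carrier G) f y)"
proof -
  obtain E where E: "finite E" "E \<subseteq> carrier G"
      "restrict x (carrier G - E) = restrict y (carrier G - E)"
    using assms unfolding asymptotic_def by blast
  have "x h = y h" if "h \<in> carrier G - E" for h
    using fun_cong[OF E(3), of h] that by simp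
  then have "restrict (compose (carrier G) f x) (carrier G - E)
      = restrict (compose (carrier G) f y) (carrier G - E)"
    by (auto simp: compose_def restrict_def)
  then show ?thesis using E unfolding asymptotic_def by blast
qed

lemma post_injunctiveD:
  fixes G :: "('g, 'm) monoid_scheme" and A :: "'a set"
  assumes G: "group G" and inj: "post_injunctive G" and fin: "finite A"
    and ca: "cellular_automaton G A \<tau>" and ps: "post_surjective G A \<tau>"
  shows "pre_injective G A \<tau>"
proof -
  interpret group G by (rule G)
  obtain f :: "'a \<Rightarrow> nat" where f: "inj_on f A"
    using finite_imp_inj_to_nat_seg[OF fin] by blast
  define B where "B = f ` A"
  define k where "k = inv_into A f"
  have kf: "k (f a) = a" if "a \<in> A" for a using that f by (simp add: k_def)
  have fk: "f (k b) = b" if "b \<in> B" for b using that by (simp add: k_def B_def f_inv_into_f)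
  have kA: "k b \<in> A" if "b \<in> B" for b using that by (simp add: k_def B_def inv_into_into)
  have fB: "f a \<in> B" if "a \<in> A" for a using that by (simp add: B_def)
  define c where "c = (\<lambda>x :: 'g \<Rightarrow> 'a. compose (carrier G) f x)"
  define d where "d = (\<lambda>x :: 'g \<Rightarrow> nat. compose (carrier G) k x)"
  have c_in: "c x \<in> configs G B" if "x \<in> configs G A" for x
    using that fB by (auto simp: c_def configs_def compose_def PiE_iff)
  have d_in: "d x \<in> configs G A" if "x \<in> configs G B" for x
    using that kA by (auto simp: d_def configs_def compose_def PiE_iff)
  have dc: "d (c x) = x" if "x \<in> configs G A" for x
    using that kf
    by (auto simp: c_def d_def configs_def compose_def PiE_iff fun_eq_iff extensional_def)
  have cd: "c (d x) = x" if "x \<in> configs G B" for x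
    using that fk
    by (auto simp: c_def d_def configs_def compose_def PiE_iff fun_eq_iff extensional_def)
  have c_as: "asymptotic G x y \<Longrightarrow> asymptotic G (c x) (c y)" for x y
    unfolding c_def by (rule asymptotic_compose)
  have d_as: "asymptotic G x y \<Longrightarrow> asymptotic G (d x) (d y)" for x y
    unfolding d_def by (rule asymptotic_compose)
  define \<sigma> where "\<sigma> = (\<lambda>x. c (\<tau> (d x)))"
  have \<tau>_in: "\<tau> x \<in> configs G A" if "x \<in> configs G A" for x
    using ca that unfolding cellular_automaton_def by blast
  have "cellular_automaton G B \<sigma>"
  proof -
    obtain M \<mu> where M: "finite M" "M \<subseteq> carrier G" "\<mu> \<in> (M \<rightarrow>\<^sub>E A) \<rightarrow> A"
      and \<mu>: "\<And>x g. x \<in> configs G A \<Longrightarrow> g \<in> carrier G \<Longrightarrow>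
                \<tau> x g = \<mu> (restrict (shift G (inv\<^bsub>G\<^esub> g) x) M)"
      using ca unfolding cellular_automaton_def by blast
    define \<nu> where "\<nu> = (\<lambda>p. f (\<mu> (compose M k p)))"
    have "\<nu> \<in> (M \<rightarrow>\<^sub>E B) \<rightarrow> B"
    proof
      fix p assume "p \<in> M \<rightarrow>\<^sub>E B"
      then have "compose M k p \<in> M \<rightarrow>\<^sub>E A" using kA by (auto simp: compose_def PiE_iff)
      then show "\<nu> p \<in> B" using M(3) fB by (auto simp: \<nu>_def)
    qed
    moreover have "\<sigma> x g = \<nu> (restrict (shift G (inv\<^bsub>G\<^esub> g) x) M)"
      if x: "x \<in> configs G B" and g: "g \<in> carrier G" for x g
    proof -
      have "restrict (shift G (inv\<^bsub>G\<^esub> g) (d x)) M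
          = compose M k (restrict (shift G (inv\<^bsub>G\<^esub> g) x) M)"
        using M(2) g by (auto simp: fun_eq_iff compose_def shift_def d_def restrict_def)
      then show ?thesis
        using \<mu>[OF d_in[OF x] g] g by (simp add: \<sigma>_def c_def \<nu>_def compose_def)
    qed
    moreover have "\<sigma> \<in> configs G B \<rightarrow> configs G B"
      using c_in d_in \<tau>_in by (auto simp: \<sigma>_def)
    ultimately show ?thesis using M unfolding cellular_automaton_def by blast
  qed
  moreover have "post_surjective G B \<sigma>"
    unfolding post_surjective_def
  proof (intro ballI impI)
    fix x y assume x: "x \<in> configs G B" and y: "y \<in> configs G B"
      and as: "asymptotic G y (\<sigma> x)"
    have "asymptotic G (d y) (\<tau> (d x))"
      using d_as[OF as] dc[OF \<tau>_in[OF d_in[OF x]]] by (simp add: \<sigma>_def)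
    then obtain z where z: "z \<in> configs G A" "asymptotic G z (d x)" "\<tau> z = d y"
      using ps d_in[OF x] d_in[OF y] unfolding post_surjective_def by blast
    have "asymptotic G (c z) x" using c_as[OF z(2)] cd[OF x] by simp
    moreover have "\<sigma> (c z) = y" using z dc cd[OF y] by (simp add: \<sigma>_def)
    ultimately show "\<exists>z\<in>configs G B. asymptotic G z x \<and> \<sigma> z = y" using c_in[OF z(1)] by blast
  qed
  moreover have "finite B" using fin by (simp add: B_def)
  ultimately have pre: "pre_injective G B \<sigma>"
    using inj unfolding post_injunctive_def by blast
  show ?thesis
    unfolding pre_injective_def
  proof (intro ballI impI)
    fix x y assume x: "x \<in> configs G A" and y: "y \<in> configs G A"
      and as: "asymptotic G x y" and eq: "\<tau> x = \<tau> y"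
    have "\<sigma> (c x) = \<sigma> (c y)" using dc[OF x] dc[OF y] eq by (simp add: \<sigma>_def)
    then have "c x = c y"
      using pre c_in[OF x] c_in[OF y] c_as[OF as] unfolding pre_injective_def by blast
    then show "x = y" using dc[OF x] dc[OF y] by metis
  qed
qed

end

theory Submission
  imports Defs
begin

text \<open>
  The value \<open>\<tau>(x)(g)\<close> depends only on the \<open>x(gm)\<close> with \<open>m \<in> M\<close>, so if the memory set \<open>M\<close> lies in
  a subgroup \<open>H\<close>, then \<open>\<tau>\<close> acts independently on the left cosets \<open>gH\<close>, and on each of them it is a
  copy of the automaton \<open>\<tau>\<^sub>H\<close> over \<open>H\<close> with the same local transition map. Asymptotic configurations
  differ on finitely many cosets only, hence \<open>\<tau>\<close> is post-surjective (pre-injective) iff \<open>\<tau>\<^sub>H\<close> is.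
  Finite generation enters because one can take \<open>H\<close> to be generated by \<open>M\<close>.
\<close>

section \<open>Explicit local form of cellular automata\<close>

definition block_map ::
    "('g, 'm) monoid_scheme \<Rightarrow> 'g set \<Rightarrow> (('g \<Rightarrow> 'a) \<Rightarrow> 'a) \<Rightarrow> ('g \<Rightarrow> 'a) \<Rightarrow> 'g \<Rightarrow> 'a"
  where "block_map G M \<mu> x = (\<lambda>g\<in>carrier G. \<mu> (\<lambda>m\<in>M. x (g \<otimes>\<^bsub>G\<^esub> m)))"

text \<open>The set of disagreements is the least admissible \<open>E\<close>. In this form
  asymptoticity passes along inclusions and injective images of finite sets.\<close>

lemma asymptotic_iff_finite:
  "asymptotic G x y \<longleftrightarrow> finite {g \<in> carrier G. x g \<noteq> y g}"
proof
  assume "asymptotic G x y"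
  then obtain E where E: "finite E" "restrict x (carrier G - E) = restrict y (carrier G - E)"
    unfolding asymptotic_def by blast
  have "{g \<in> carrier G. x g \<noteq> y g} \<subseteq> E"
  proof
    fix g assume "g \<in> {g \<in> carrier G. x g \<noteq> y g}"
    then show "g \<in> E" using fun_cong[OF E(2), of g] by (auto split: if_splits)
  qed
  then show "finite {g \<in> carrier G. x g \<noteq> y g}" using E(1) finite_subset by blast
next
  assume "finite {g \<in> carrier G. x g \<noteq> y g}"
  then show "asymptotic G x y"
    unfolding asymptotic_def
    by (intro exI[of _ "{g \<in> carrier G. x g \<noteq> y g}"]) (auto simp: restrict_def)
qed

lemma post_surjective_cong:
  assumes "\<And>x. x \<in> configs G A \<Longrightarrow> \<tau> x = \<sigma> x"
  shows "post_surjective G A \<tau> \<longleftrightarrow> post_surjective G A \<sigma>"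
  unfolding post_surjective_def using assms by (metis (no_types, lifting))

lemma pre_injective_cong:
  assumes "\<And>x. x \<in> configs G A \<Longrightarrow> \<tau> x = \<sigma> x"
  shows "pre_injective G A \<tau> \<longleftrightarrow> pre_injective G A \<sigma>"
  unfolding pre_injective_def using assms by auto

context group
begin

lemma block_map_configs:
  assumes "M \<subseteq> carrier G" "\<mu> \<in> (M \<rightarrow>\<^sub>E A) \<rightarrow> A" "x \<in> configs G A"
  shows "block_map G M \<mu> x \<in> configs G A"
proof -
  have "(\<lambda>m\<in>M. x (g \<otimes> m)) \<in> M \<rightarrow>\<^sub>E A" if "g \<in> carrier G" for g
    using assms(1,3) that by (auto simp: configs_def PiE_iff)
  then have "\<mu> (\<lambda>m\<in>M. x (g \<otimes> m)) \<in> A" if "g \<in> carrier G" for g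
    using that by (intro funcset_mem[OF assms(2)])
  then show ?thesis by (auto simp: configs_def block_map_def)
qed

lemma restrict_shift_inv:
  assumes "M \<subseteq> carrier G" "g \<in> carrier G"
  shows "restrict (shift G (inv g) x) M = (\<lambda>m\<in>M. x (g \<otimes> m))"
  using assms by (auto simp: shift_def fun_eq_iff restrict_def)

text \<open>Shifting by \<open>inv g\<close> turns the pattern at \<open>g\<close> into
  \<open>m \<mapsto> x (g \<otimes> m)\<close>. Both sides are extensional, so agreement on the
  carrier gives equality of functions. The point is that one pair \<open>M\<close>,
  \<open>\<mu>\<close> can then be run over different groups.\<close>

lemma cellular_automaton_iff_block_map:
  "cellular_automaton G A \<tau> \<longleftrightarrow>
    (\<exists>M \<mu>. finite M \<and> M \<subseteq> carrier G \<and> \<mu> \<in> (M \<rightarrow>\<^sub>E A) \<rightarrow> A \<and>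
      (\<forall>x\<in>configs G A. \<tau> x = block_map G M \<mu> x))" (is "_ \<longleftrightarrow> ?R")
proof
  assume ca: "cellular_automaton G A \<tau>"
  then obtain M \<mu> where M: "finite M" "M \<subseteq> carrier G" "\<mu> \<in> (M \<rightarrow>\<^sub>E A) \<rightarrow> A"
    and \<mu>: "\<And>x g. x \<in> configs G A \<Longrightarrow> g \<in> carrier G \<Longrightarrow>
              \<tau> x g = \<mu> (restrict (shift G (inv g) x) M)"
    unfolding cellular_automaton_def by blast
  have "\<tau> x = block_map G M \<mu> x" if x: "x \<in> configs G A" for x
  proof
    fix g
    have "\<tau> x \<in> configs G A" using ca x unfolding cellular_automaton_def by blast
    then show "\<tau> x g = block_map G M \<mu> x g"
      using \<mu>[OF x] restrict_shift_inv[OF M(2), of g x]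
      by (cases "g \<in> carrier G") (auto simp: block_map_def configs_def PiE_iff extensional_def)
  qed
  then show ?R using M by blast
next
  assume ?R
  then obtain M \<mu> where M: "finite M" "M \<subseteq> carrier G" "\<mu> \<in> (M \<rightarrow>\<^sub>E A) \<rightarrow> A"
    and \<mu>: "\<And>x. x \<in> configs G A \<Longrightarrow> \<tau> x = block_map G M \<mu> x"
    by blast
  have "\<tau> \<in> configs G A \<rightarrow> configs G A" using \<mu> block_map_configs[OF M(2,3)] by auto
  moreover have "\<tau> x g = \<mu> (restrict (shift G (inv g) x) M)"
    if "x \<in> configs G A" "g \<in> carrier G" for x g
    using \<mu>[OF that(1)] restrict_shift_inv[OF M(2) that(2), of x] that(2)
    by (simp add: block_map_def)
  ultimately show "cellular_automaton G A \<tau>"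
    unfolding cellular_automaton_def using M by blast
qed

lemma cellular_automaton_block_map:
  assumes "finite M" "M \<subseteq> carrier G" "\<mu> \<in> (M \<rightarrow>\<^sub>E A) \<rightarrow> A"
  shows "cellular_automaton G A (block_map G M \<mu>)"
  unfolding cellular_automaton_iff_block_map using assms by blast

text \<open>The choice \<open>SOME r. r \<in> g <# H\<close> sees \<open>g\<close> only through its
  left coset, so it is constant on that coset. The element \<open>inv (r g) \<otimes> g\<close> is
  the coordinate of \<open>g\<close> in \<open>H\<close> relative to the representative.\<close>

lemma coset_representatives:
  assumes "subgroup H G"
  obtains r where "\<And>g. g \<in> carrier G \<Longrightarrow> r g \<in> carrier G"
    and "\<And>g. g \<in> carrier G \<Longrightarrow> inv (r g) \<otimes> g \<in> H"
    and "\<And>g h. g \<in> carrier G \<Longrightarrow> h \<in> H \<Longrightarrow> r (g \<otimes> h) = r g"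
proof -
  interpret H: subgroup H G by (rule assms)
  define r where "r g = (SOME r. r \<in> g <# H)" for g
  have r: "r g \<in> g <# H" if "g \<in> carrier G" for g
    unfolding r_def
  proof (rule someI)
    show "g \<in> g <# H" using that H.one_closed r_one[OF that] unfolding l_coset_def by force
  qed
  have rH: "\<exists>h\<in>H. r g = g \<otimes> h" if "g \<in> carrier G" for g
    using r[OF that] by (auto simp: l_coset_def)
  show ?thesis
  proof (rule that[of r])
    fix g assume g: "g \<in> carrier G"
    obtain h where h: "h \<in> H" "r g = g \<otimes> h" using rH[OF g] by blast
    then show "r g \<in> carrier G" using g by simp
    show "inv (r g) \<otimes> g \<in> H" using h g by (simp add: inv_mult_group m_assoc)
  next
    fix g h assume g: "g \<in> carrier G" and h: "h \<in> H"
    then have "(g \<otimes> h) \<in> g <# H" by (auto simp: l_coset_def)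
    then have "(g \<otimes> h) <# H = g <# H"
      using l_repr_independence[OF _ g assms] by simp
    then show "r (g \<otimes> h) = r g" by (simp add: r_def)
  qed
qed

section \<open>One local rule run over a group and over a subgroup\<close>

context
  fixes H M :: "'a set" and \<mu> :: "('a \<Rightarrow> 'c) \<Rightarrow> 'c" and A :: "'c set"
  assumes H: "subgroup H G" and M: "M \<subseteq> H" and \<mu>: "\<mu> \<in> (M \<rightarrow>\<^sub>E A) \<rightarrow> A"
begin

interpretation H: subgroup H G by (rule H)

abbreviation (input) "K \<equiv> G\<lparr>carrier := H\<rparr>"
text \<open>The restriction of \<open>x\<close> to the coset \<open>gH\<close>, pulled back to
  \<open>H\<close> along left translation by \<open>g\<close>; for \<open>g = \<one>\<close> it is
  the plain restriction to \<open>H\<close>.\<close>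

abbreviation (input) "coset_config x g \<equiv> (\<lambda>h\<in>H. x (g \<otimes> h))"

lemma coset_config_in:
  "x \<in> configs G A \<Longrightarrow> g \<in> carrier G \<Longrightarrow> coset_config x g \<in> configs K A"
  by (auto simp: configs_def PiE_iff)

text \<open>Since \<open>M \<subseteq> H\<close>, the window of a cell \<open>g \<otimes> h\<close>
  stays in the coset \<open>gH\<close>, and associativity identifies it with the window of
  \<open>h\<close> in \<open>H\<close>.\<close>

lemma block_map_coset_config:
  assumes "g \<in> carrier G"
  shows "block_map K M \<mu> (coset_config x g) = coset_config (block_map G M \<mu> x) g"
proof
  fix h
  have "(\<lambda>m\<in>M. coset_config x g (h \<otimes> m)) = (\<lambda>m\<in>M. x (g \<otimes> h \<otimes> m))" if "h \<in> H"
    using assms M that by (auto simp: restrict_def fun_eq_iff m_assoc subsetD)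
  then show "block_map K M \<mu> (coset_config x g) h = coset_config (block_map G M \<mu> x) g h"
    using assms by (cases "h \<in> H") (simp_all add: block_map_def)
qed

text \<open>Left translation by \<open>g\<close> embeds the disagreements of the pulled-back
  configurations into those of \<open>x\<close> and \<open>y\<close>.\<close>

lemma asymptotic_coset_config:
  assumes "g \<in> carrier G" "asymptotic G x y"
  shows "asymptotic K (coset_config x g) (coset_config y g)"
proof -
  have "finite ((\<otimes>) g ` {h \<in> H. x (g \<otimes> h) \<noteq> y (g \<otimes> h)})"
    using assms by (auto simp: asymptotic_iff_finite elim!: rev_finite_subset)
  moreover have "inj_on ((\<otimes>) g) {h \<in> H. x (g \<otimes> h) \<noteq> y (g \<otimes> h)}"
    using assms(1) by (auto simp: inj_on_def)
  ultimately have "finite {h \<in> H. x (g \<otimes> h) \<noteq> y (g \<otimes> h)}"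
    by (rule finite_imageD)
  then show ?thesis
    by (auto simp: asymptotic_iff_finite elim!: rev_finite_subset)
qed

lemma coset_config_one:
  assumes "x \<in> H \<rightarrow>\<^sub>E A" "\<And>h. h \<in> H \<Longrightarrow> x' h = x h"
  shows "coset_config x' \<one> = x"
  using assms by (auto simp: fun_eq_iff PiE_iff extensional_def)

lemma extend_config:
  assumes "x \<in> configs K A" "b \<in> configs G A"
  shows "(\<lambda>g. if g \<in> H then x g else b g) \<in> configs G A"
  using assms by (auto simp: configs_def PiE_iff extensional_def)

text \<open>Taking the filler symbol from \<open>x\<close> itself avoids a separate case for an
  empty alphabet.\<close>

lemma constant_extension_in:
  assumes "x \<in> configs K A"
  shows "(\<lambda>g\<in>carrier G. x \<one>) \<in> configs G A"
  using assms H.one_closed by (auto simp: configs_def PiE_iff)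

section \<open>Transfer of pre-injectivity\<close>

lemma pre_injective_extension:
  assumes pre: "pre_injective K A (block_map K M \<mu>)"
  shows "pre_injective G A (block_map G M \<mu>)"
  unfolding pre_injective_def
proof (intro ballI impI)
  fix x y assume x: "x \<in> configs G A" and y: "y \<in> configs G A"
    and as: "asymptotic G x y" and eq: "block_map G M \<mu> x = block_map G M \<mu> y"
  have "x g = y g" if g: "g \<in> carrier G" for g
  proof -
    \<comment> \<open>Both asymptoticity and equality of images survive on the single coset
      \<open>gH\<close>, so the hypothesis over \<open>H\<close> applies there; the entry at
      \<open>\<one>\<close> then recovers \<open>x g = y g\<close>.\<close>
    have "coset_config x g = coset_config y g"
      using pre coset_config_in[OF x g] coset_config_in[OF y g] asymptotic_coset_config[OF g as]
        block_map_coset_config[OF g] eq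
      unfolding pre_injective_def by metis
    from fun_cong[OF this, of \<one>] show ?thesis using g by simp
  qed
  then show "x = y" using x y by (auto simp: configs_def intro: PiE_ext)
qed

text \<open>Two configurations on \<open>H\<close> are filled up by the same background
  \<open>b\<close>. No new disagreement arises, and the images agree on \<open>H\<close> by
  assumption and off \<open>H\<close> because only the background is seen there.\<close>

lemma pre_injective_restriction:
  assumes pre: "pre_injective G A (block_map G M \<mu>)"
  shows "pre_injective K A (block_map K M \<mu>)"
  unfolding pre_injective_def
proof (intro ballI impI)
  fix x y assume x: "x \<in> configs K A" and y: "y \<in> configs K A"
    and as: "asymptotic K x y" and eq: "block_map K M \<mu> x = block_map K M \<mu> y"
  define b where "b = (\<lambda>g\<in>carrier G. x \<one>)"
  have b: "b \<in> configs G A" unfolding b_def by (rule constant_extension_in[OF x])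
  define x' where "x' = (\<lambda>g. if g \<in> H then x g else b g)"
  define y' where "y' = (\<lambda>g. if g \<in> H then y g else b g)"
  have x': "x' \<in> configs G A" unfolding x'_def by (rule extend_config[OF x b])
  have y': "y' \<in> configs G A" unfolding y'_def by (rule extend_config[OF y b])
  have cx: "coset_config x' \<one> = x" and cy: "coset_config y' \<one> = y"
    using x y by (auto intro!: coset_config_one simp: configs_def x'_def y'_def)
  have "{g \<in> carrier G. x' g \<noteq> y' g} \<subseteq> {g \<in> carrier K. x g \<noteq> y g}"
    by (auto simp: x'_def y'_def)
  then have as': "asymptotic G x' y'"
    using as unfolding asymptotic_iff_finite by (rule finite_subset)
  have "block_map G M \<mu> x' g = block_map G M \<mu> y' g" if g: "g \<in> carrier G" for g
  proof (cases "g \<in> H")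
    case True
    have "coset_config (block_map G M \<mu> x') \<one> = coset_config (block_map G M \<mu> y') \<one>"
      using block_map_coset_config[of \<one> x'] block_map_coset_config[of \<one> y'] cx cy eq by simp
    from fun_cong[OF this, of g] show ?thesis using True by simp
  next
    case False
    \<comment> \<open>The window of a cell outside \<open>H\<close> misses \<open>H\<close>
      altogether, so it contains only values of \<open>b\<close>.\<close>
    have "g \<otimes> m \<notin> H" if "m \<in> M" for m
    proof
      assume "g \<otimes> m \<in> H"
      then have "g \<otimes> m \<otimes> inv m \<in> H" using that M by blast
      then show False using False that M g by (simp add: m_assoc subsetD)
    qed
    then have "(\<lambda>m\<in>M. x' (g \<otimes> m)) = (\<lambda>m\<in>M. y' (g \<otimes> m))"
      by (auto simp: x'_def y'_def)
    then show ?thesis by (simp add: block_map_def)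
  qed
  then have "block_map G M \<mu> x' = block_map G M \<mu> y'"
    by (auto simp: block_map_def fun_eq_iff)
  then have "x' = y'" using pre x' y' as' unfolding pre_injective_def by blast
  then show "x = y" using cx cy by metis
qed

section \<open>Transfer of post-surjectivity\<close>

lemma post_surjective_restriction:
  assumes post: "post_surjective G A (block_map G M \<mu>)"
  shows "post_surjective K A (block_map K M \<mu>)"
  unfolding post_surjective_def
proof (intro ballI impI)
  fix x y assume x: "x \<in> configs K A" and y: "y \<in> configs K A"
    and as: "asymptotic K y (block_map K M \<mu> x)"
  define x' where "x' = (\<lambda>g. if g \<in> H then x g else (\<lambda>g\<in>carrier G. x \<one>) g)"
  have x': "x' \<in> configs G A"
    unfolding x'_def by (rule extend_config[OF x constant_extension_in[OF x]])
  have cx: "coset_config x' \<one> = x"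
    using x by (auto intro!: coset_config_one simp: configs_def x'_def)
  \<comment> \<open>Off \<open>H\<close> the target is the image of \<open>x'\<close> itself, so all
    disagreements lie in \<open>H\<close>, where they are those of \<open>y\<close> and the image of
    \<open>x\<close>.\<close>
  define y' where "y' = (\<lambda>g. if g \<in> H then y g else block_map G M \<mu> x' g)"
  have y': "y' \<in> configs G A"
    unfolding y'_def using M H.subset
    by (intro extend_config[OF y] block_map_configs[OF _ \<mu> x']) blast
  have cy: "coset_config y' \<one> = y"
    using y by (auto intro!: coset_config_one simp: configs_def y'_def)
  have eqH: "block_map G M \<mu> x' g = block_map K M \<mu> x g" if "g \<in> H" for g
    using fun_cong[OF block_map_coset_config[of \<one> x'], of g] that cx by simp
  have "{g \<in> carrier G. y' g \<noteq> block_map G M \<mu> x' g}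
      \<subseteq> {g \<in> carrier K. y g \<noteq> block_map K M \<mu> x g}"
    using eqH by (auto simp: y'_def)
  then have "asymptotic G y' (block_map G M \<mu> x')"
    using as unfolding asymptotic_iff_finite by (rule finite_subset)
  then obtain z where z: "z \<in> configs G A" "asymptotic G z x'" "block_map G M \<mu> z = y'"
    using post x' y' unfolding post_surjective_def by blast
  have "asymptotic K (coset_config z \<one>) x"
    using asymptotic_coset_config[OF one_closed z(2)] unfolding cx .
  moreover have "block_map K M \<mu> (coset_config z \<one>) = y"
    using block_map_coset_config[OF one_closed, of z] unfolding z(3) cy .
  ultimately show "\<exists>z\<in>configs K A. asymptotic K z x \<and> block_map K M \<mu> z = y"
    using coset_config_in[OF z(1) one_closed] by blast
qed

text \<open>The problem is solved on every coset separately and the solutions are glued. Only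
  finitely many cosets meet the error set \<open>D\<close>, and each contributes a finite
  correction.\<close>

lemma post_surjective_extension:
  assumes post: "post_surjective K A (block_map K M \<mu>)"
  shows "post_surjective G A (block_map G M \<mu>)"
  unfolding post_surjective_def
proof (intro ballI impI)
  fix x y assume x: "x \<in> configs G A" and y: "y \<in> configs G A"
    and as: "asymptotic G y (block_map G M \<mu> x)"
  obtain r where r: "\<And>g. g \<in> carrier G \<Longrightarrow> r g \<in> carrier G"
    and rH: "\<And>g. g \<in> carrier G \<Longrightarrow> inv (r g) \<otimes> g \<in> H"
    and r_mult: "\<And>g h. g \<in> carrier G \<Longrightarrow> h \<in> H \<Longrightarrow> r (g \<otimes> h) = r g"
    using coset_representatives[OF H] by blast
  have rr: "r g \<otimes> (inv (r g) \<otimes> g) = g" if "g \<in> carrier G" for g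
    using r[OF that] that by (simp add: m_assoc[symmetric])
  define D where "D = {g \<in> carrier G. y g \<noteq> block_map G M \<mu> x g}"
  have finD: "finite D" using as by (simp add: D_def asymptotic_iff_finite)
  \<comment> \<open>Keeping \<open>x\<close> on the cosets that need no correction makes the corrections finite in total.\<close>
  have "\<exists>z\<in>configs K A. asymptotic K z (coset_config x g) \<and> block_map K M \<mu> z = coset_config y g
      \<and> (block_map K M \<mu> (coset_config x g) = coset_config y g \<longrightarrow> z = coset_config x g)"
    if g: "g \<in> carrier G" for g
  proof (cases "block_map K M \<mu> (coset_config x g) = coset_config y g")
    case True
    then show ?thesis
      using coset_config_in[OF x g]
      by (intro bexI[of _ "coset_config x g"]) (auto simp: asymptotic_iff_finite)
  next
    case False
    have "asymptotic K (coset_config y g) (block_map K M \<mu> (coset_config x g))"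
      unfolding block_map_coset_config[OF g] by (rule asymptotic_coset_config[OF g as])
    then show ?thesis
      using False post coset_config_in[OF x g] coset_config_in[OF y g]
      unfolding post_surjective_def by blast
  qed
  \<comment> \<open>The solutions \<open>z g\<close> for different \<open>g\<close> in one coset
    need not be compatible; only those at representatives are used for gluing.\<close>
  then obtain z where z: "\<And>g. g \<in> carrier G \<Longrightarrow> z g \<in> configs K A"
    and z_as: "\<And>g. g \<in> carrier G \<Longrightarrow> asymptotic K (z g) (coset_config x g)"
    and z_eq: "\<And>g. g \<in> carrier G \<Longrightarrow> block_map K M \<mu> (z g) = coset_config y g"
    and z_id: "\<And>g. g \<in> carrier G \<Longrightarrow>
      block_map K M \<mu> (coset_config x g) = coset_config y g \<Longrightarrow> z g = coset_config x g"
    by metis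
  \<comment> \<open>All cells of a coset read the same solution \<open>z (r g)\<close>, each at its
    own coordinate in \<open>H\<close>.\<close>
  define Z where "Z = (\<lambda>g\<in>carrier G. z (r g) (inv (r g) \<otimes> g))"
  have "Z \<in> configs G A"
    using z[OF r] rH by (auto simp: Z_def configs_def PiE_iff)
  moreover have "asymptotic G Z x"
  proof -
    define F where "F s = {h \<in> H. z s h \<noteq> coset_config x s h}" for s
    have "finite (F (r g))" if "g \<in> carrier G" for g
      using z_as[OF r[OF that]] by (simp add: asymptotic_iff_finite F_def)
    \<comment> \<open>Indexing by error cells instead of cosets may list a coset several times, but
      keeps the union finite.\<close>
    then have "finite (\<Union>g\<in>D. (\<otimes>) (r g) ` F (r g))"
      using finD by (auto simp: D_def)
    moreover have "{g \<in> carrier G. Z g \<noteq> x g} \<subseteq> (\<Union>g\<in>D. (\<otimes>) (r g) ` F (r g))"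
    proof
      fix g assume "g \<in> {g \<in> carrier G. Z g \<noteq> x g}"
      then have g: "g \<in> carrier G" and ne: "Z g \<noteq> x g" by auto
      define h where "h = inv (r g) \<otimes> g"
      have h: "h \<in> H" and gh: "g = r g \<otimes> h" using rH[OF g] rr[OF g] by (simp_all add: h_def)
      have "z (r g) h \<noteq> coset_config x (r g) h"
        using ne g h gh by (simp add: Z_def h_def)
      then have hF: "h \<in> F (r g)" and "z (r g) \<noteq> coset_config x (r g)"
        using h by (auto simp: F_def)
      \<comment> \<open>By \<open>z_id\<close>, a coset on which \<open>x\<close> was changed must
        contain an error cell, namely some \<open>r g \<otimes> k\<close>.\<close>
      then have "coset_config (block_map G M \<mu> x) (r g) \<noteq> coset_config y (r g)"
        using z_id[OF r[OF g]] block_map_coset_config[OF r[OF g], of x] by auto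
      then obtain k where k: "k \<in> H" "block_map G M \<mu> x (r g \<otimes> k) \<noteq> y (r g \<otimes> k)"
        by (auto simp: fun_eq_iff split: if_splits)
      have kD: "r g \<otimes> k \<in> D" using k r[OF g] by (auto simp: D_def)
      \<comment> \<open>The error cell lies in the coset of \<open>g = r g \<otimes> h\<close>,
        hence has the same representative and indexes the part of the union containing
        \<open>g\<close>.\<close>
      have "r (r g \<otimes> k) = r (r g \<otimes> h)" using r_mult[OF r[OF g]] k h by simp
      then have "r (r g \<otimes> k) = r g" using gh by simp
      then show "g \<in> (\<Union>g\<in>D. (\<otimes>) (r g) ` F (r g))"
        using kD hF gh by (metis UN_I imageI)
    qed
    ultimately show ?thesis unfolding asymptotic_iff_finite by (rule rev_finite_subset)
  qed
  moreover have "block_map G M \<mu> Z = y"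
  proof
    fix g
    show "block_map G M \<mu> Z g = y g"
    proof (cases "g \<in> carrier G")
      case True
      \<comment> \<open>As \<open>m \<in> H\<close>, the whole window of \<open>g\<close> has the
        representative \<open>r g\<close>, so \<open>Z\<close> follows a single solution on
        it.\<close>
      have "Z (g \<otimes> m) = z (r g) (inv (r g) \<otimes> g \<otimes> m)" if "m \<in> M" for m
      proof -
        have m: "m \<in> H" using that M by blast
        then show ?thesis using True r[OF True] r_mult[OF True m] by (simp add: Z_def m_assoc)
      qed
      then have "block_map G M \<mu> Z g = block_map K M \<mu> (z (r g)) (inv (r g) \<otimes> g)"
        using True rH[OF True] by (simp add: block_map_def cong: restrict_cong)
      also have "\<dots> = y g"
        using z_eq[OF r[OF True]] rH[OF True] rr[OF True] by simp
      finally show ?thesis .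
    next
      case False
      then show ?thesis using y by (auto simp: block_map_def configs_def PiE_iff extensional_def)
    qed
  qed
  ultimately show "\<exists>z\<in>configs G A. asymptotic G z x \<and> block_map G M \<mu> z = y" by blast
qed

end

section \<open>Inheritance by subgroups, and the local criterion\<close>

lemma post_injunctive_subgroup:
  assumes H: "subgroup H G" and inj: "post_injunctive G"
  shows "post_injunctive (G\<lparr>carrier := H\<rparr>)"
  unfolding post_injunctive_def
proof (intro allI impI)
  fix A :: "nat set" and \<tau>
  let ?K = "G\<lparr>carrier := H\<rparr>"
  assume fin: "finite A" and ca: "cellular_automaton ?K A \<tau>" and ps: "post_surjective ?K A \<tau>"
  obtain M \<mu> where M: "finite M" "M \<subseteq> H" "\<mu> \<in> (M \<rightarrow>\<^sub>E A) \<rightarrow> A"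
    and \<tau>: "\<And>x. x \<in> configs ?K A \<Longrightarrow> \<tau> x = block_map ?K M \<mu> x"
    using ca group.cellular_automaton_iff_block_map[OF subgroup_imp_group[OF H], of A \<tau>] by auto
  have "M \<subseteq> carrier G" using M(2) subgroup.subset[OF H] by blast
  then have "cellular_automaton G A (block_map G M \<mu>)"
    using cellular_automaton_block_map M by blast
  \<comment> \<open>The rule on \<open>H\<close> is run unchanged over the whole group:
    post-surjectivity goes up, and pre-injectivity comes back down.\<close>
  moreover have "post_surjective G A (block_map G M \<mu>)"
    using post_surjective_extension[OF H M(2,3)] ps
      post_surjective_cong[of ?K A \<tau> "block_map ?K M \<mu>", OF \<tau>] by blast
  ultimately have "pre_injective G A (block_map G M \<mu>)"
    using inj fin unfolding post_injunctive_def by blast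
  then show "pre_injective ?K A \<tau>"
    using pre_injective_restriction[OF H M(2,3)]
      pre_injective_cong[of ?K A \<tau> "block_map ?K M \<mu>", OF \<tau>] by blast
qed

lemma finitely_generated_generate:
  assumes "finite S" "S \<subseteq> carrier G"
  shows "finitely_generated (G\<lparr>carrier := generate G S\<rparr>)"
proof -
  have S: "S \<subseteq> generate G S" by (auto intro: generate.incl)
  then have "generate (G\<lparr>carrier := generate G S\<rparr>) S = generate G S"
    using generate_consistent[OF _ generate_is_subgroup[OF assms(2)]] by blast
  then show ?thesis unfolding finitely_generated_def using assms(1) S by auto
qed

text \<open>Here the transfer runs the other way. The subgroup generated by the finite memory set
  carries the same rule: post-surjectivity goes down to it, and pre-injectivity comes back
  up.\<close>

lemma post_injunctive_if_locally:
  assumes loc: "locally_post_injunctive G"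
  shows "post_injunctive G"
  unfolding post_injunctive_def
proof (intro allI impI)
  fix A :: "nat set" and \<tau>
  assume fin: "finite A" and ca: "cellular_automaton G A \<tau>" and ps: "post_surjective G A \<tau>"
  obtain M \<mu> where M: "finite M" "M \<subseteq> carrier G" "\<mu> \<in> (M \<rightarrow>\<^sub>E A) \<rightarrow> A"
    and \<tau>: "\<And>x. x \<in> configs G A \<Longrightarrow> \<tau> x = block_map G M \<mu> x"
    using ca unfolding cellular_automaton_iff_block_map by blast
  define H where "H = generate G M"
  let ?K = "G\<lparr>carrier := H\<rparr>"
  have H: "subgroup H G" unfolding H_def by (rule generate_is_subgroup[OF M(2)])
  have MH: "M \<subseteq> H" by (auto simp: H_def intro: generate.incl)
  have "post_injunctive ?K"
    using loc H finitely_generated_generate[OF M(1,2)]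
    unfolding locally_post_injunctive_def H_def by blast
  moreover have "cellular_automaton ?K A (block_map ?K M \<mu>)"
    using group.cellular_automaton_block_map[OF subgroup_imp_group[OF H]] M MH by simp
  moreover have "post_surjective ?K A (block_map ?K M \<mu>)"
    using post_surjective_restriction[OF H MH M(3)] ps
      post_surjective_cong[of G A \<tau> "block_map G M \<mu>", OF \<tau>] by blast
  ultimately have "pre_injective ?K A (block_map ?K M \<mu>)"
    using fin unfolding post_injunctive_def by blast
  then show "pre_injective G A \<tau>"
    using pre_injective_extension[OF H MH M(3)]
      pre_injective_cong[of G A \<tau> "block_map G M \<mu>", OF \<tau>] by blast
qed

end

theorem theorem5p4:
  fixes G :: "('g, 'm) monoid_scheme"
  assumes "group G"
  shows "post_injunctive G \<longleftrightarrow> locally_post_injunctive G"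
  using group.post_injunctive_subgroup[OF assms] group.post_injunctive_if_locally[OF assms]
  unfolding locally_post_injunctive_def by blast

end
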